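(* Let $\mathcal{H}$ be a separable Hilbert space, $I$ a countable index set, and $\varphi=\{\varphi_i\}_{i\in I}$ a frame for $\mathcal{H}$ such that the norm of its redundant elements is small enough. Then $\varphi$ is woven with its canonical dual $\{S_\varphi^{-1}\varphi_i\}_{i\in I}$.
   Context: A family $\{\varphi_i\}_{i\in I}$ in $\mathcal{H}$ is a frame for $\mathcal{H}$ with bounds $0<A_\varphi\le B_\varphi<\infty$ if $A_\varphi\Vert f\Vert^2\le\sum_{i\in I}|\langle f,\varphi_i\rangle|^2\le B_\varphi\Vert f\Vert^2$ for all $f\in\mathcal{H}$. The frame operator is $S_\varphi f=\sum_{i\in I}\langle f,\varphi_i\rangle\varphi_i$, which is bounded, invertible and self-adjoint; the canonical dual of $\varphi$ is $\{S_\varphi^{-1}\varphi_i\}_{i\in I}$. Two frames $\{\varphi_i\}_{i\in I}$ and $\{\psi_i\}_{i\in I}$ for $\mathcal{H}$ are woven if there are constants $0<A\le B<\infty$ (universal bounds) such that for every $J\subseteq I$ the family $\{\varphi_i\}_{i\in J}\cup\{\psi_i\}_{i\in J^c}$ (with $J^c=I\setminus J$, counted with indices) is a frame for $\mathcal{H}$ with bounds $A$ and $B$. Redundant elements: the frame is written as $\varphi=\{\varphi_i\}_{i\in I\setminus\sigma}\cup\{\varphi_i\}_{i\in\sigma}$, where $\phi=\{\varphi_i\}_{i\in I\setminus\sigma}$ is a Riesz basis for $\mathcal{H}$ and $\sigma\subseteq I$ is finite (with $n$ elements when the excess of $\varphi$, the greatest number of elements that can be deleted from $\varphi$ so as to still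 leave a frame, is $n$) or infinite (when the excess is infinite); the elements $\varphi_i$, $i\in\sigma$, are the redundant elements of $\varphi$. Small enough: $\sum_{i\in\sigma}\Vert\varphi_i\Vert^2<\sqrt{A/B_\varphi}$, where $B_\varphi$ is an upper frame bound of $\varphi$ and $A$ is a universal lower bound of the woven frames $\phi$ and $\{S_\phi\varphi_i\}_{i\in I\setminus\sigma}$, with $S_\phi$ the frame operator of $\phi$. *)

theory Defs
  imports "HOL-Analysis.Analysis" "HOL-Library.Extended_Nat"
begin

text \<open>
  A real normed field (with multiplicative norm) is isomorphic to the reals or to the complex
  numbers, and the axioms below force the conjugation to be the usual one. This covers real and
  complex Hilbert spaces simultaneously.
\<close>

class real_or_complex = real_normed_field +
  fixes scnj :: "'a \<Rightarrow> 'a"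
  assumes scnj_add: "scnj (a + b) = scnj a + scnj b"
    and scnj_mult: "scnj (a * b) = scnj a * scnj b"
    and scnj_scnj: "scnj (scnj a) = a"
    and scnj_scaleR: "scnj (r *\<^sub>R a) = r *\<^sub>R scnj a"
    and mult_scnj: "a * scnj a = (norm a)\<^sup>2 *\<^sub>R 1"

instantiation real :: real_or_complex
begin
definition scnj_real :: "real \<Rightarrow> real" where "scnj_real x = x"
instance by standard (simp_all add: scnj_real_def power2_eq_square)
end

instantiation complex :: real_or_complex
begin
definition scnj_complex :: "complex \<Rightarrow> complex" where "scnj_complex z = cnj z"
instance by standard (simp_all add: scnj_complex_def complex_norm_square [symmetric] scaleR_conv_of_real)
end

text \<open>
  Completeness and the topology come from the class of Banach spaces; the inner product,
  linear in its first argument, induces the norm of that class.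
\<close>

locale hilbert_space = vector_space smul
  for smul :: "'k::real_or_complex \<Rightarrow> 'h::banach \<Rightarrow> 'h" +
  fixes ip :: "'h \<Rightarrow> 'h \<Rightarrow> 'k"
  assumes scale_of_real: "smul (of_real r) x = r *\<^sub>R x"
    and ip_add_left: "ip (x + y) z = ip x z + ip y z"
    and ip_scale_left: "ip (smul a x) y = a * ip x y"
    and ip_commute: "ip x y = scnj (ip y x)"
    and ip_self: "ip x x = of_real ((norm x)\<^sup>2)"

lemma hilbert_space_real_inner:
  "hilbert_space (*\<^sub>R) ((\<bullet>) :: 'h::{real_inner, banach} \<Rightarrow> 'h \<Rightarrow> real)"
  by unfold_locales
    (simp_all add: scnj_real_def inner_add_left inner_add_right inner_commute power2_norm_eq_inner scaleR_right_distrib scaleR_left_distrib)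

lemma hilbert_space_complex: "hilbert_space (*) (\<lambda>z w :: complex. z * cnj w)"
  by unfold_locales
    (simp_all add: scnj_complex_def scaleR_conv_of_real complex_norm_square [symmetric] algebra_simps)

definition frame_bounds ::
    "('h::banach \<Rightarrow> 'h \<Rightarrow> 'k::real_or_complex) \<Rightarrow> 'i set \<Rightarrow> ('i \<Rightarrow> 'h) \<Rightarrow> real \<Rightarrow> real \<Rightarrow> bool"
  where "frame_bounds ip I \<phi> A B \<longleftrightarrow> 0 < A \<and> A \<le> B \<and>
    (\<forall>f. (\<lambda>i. (norm (ip f (\<phi> i)))\<^sup>2) summable_on I \<and>
         A * (norm f)\<^sup>2 \<le> (\<Sum>\<^sub>\<infinity>i\<in>I. (norm (ip f (\<phi> i)))\<^sup>2) \<and>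
         (\<Sum>\<^sub>\<infinity>i\<in>I. (norm (ip f (\<phi> i)))\<^sup>2) \<le> B * (norm f)\<^sup>2)"

definition is_frame :: "('h::banach \<Rightarrow> 'h \<Rightarrow> 'k::real_or_complex) \<Rightarrow> 'i set \<Rightarrow> ('i \<Rightarrow> 'h) \<Rightarrow> bool"
  where "is_frame ip I \<phi> \<longleftrightarrow> (\<exists>A B. frame_bounds ip I \<phi> A B)"

definition upper_frame_bound :: "('h::banach \<Rightarrow> 'h \<Rightarrow> 'k::real_or_complex) \<Rightarrow> 'i set \<Rightarrow> ('i \<Rightarrow> 'h) \<Rightarrow> real \<Rightarrow> bool"
  where "upper_frame_bound ip I \<phi> B \<longleftrightarrow> (\<exists>A. frame_bounds ip I \<phi> A B)"

definition frame_operator ::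
    "('k::real_or_complex \<Rightarrow> 'h::banach \<Rightarrow> 'h) \<Rightarrow> ('h \<Rightarrow> 'h \<Rightarrow> 'k) \<Rightarrow> 'i set \<Rightarrow> ('i \<Rightarrow> 'h) \<Rightarrow> 'h \<Rightarrow> 'h"
  where "frame_operator smul ip I \<phi> f = (\<Sum>\<^sub>\<infinity>i\<in>I. smul (ip f (\<phi> i)) (\<phi> i))"

definition canonical_dual ::
    "('k::real_or_complex \<Rightarrow> 'h::banach \<Rightarrow> 'h) \<Rightarrow> ('h \<Rightarrow> 'h \<Rightarrow> 'k) \<Rightarrow> 'i set \<Rightarrow> ('i \<Rightarrow> 'h) \<Rightarrow> 'i \<Rightarrow> 'h"
  where "canonical_dual smul ip I \<phi> i = inv (frame_operator smul ip I \<phi>) (\<phi> i)"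

definition weaving :: "'i set \<Rightarrow> ('i \<Rightarrow> 'h) \<Rightarrow> ('i \<Rightarrow> 'h) \<Rightarrow> 'i \<Rightarrow> 'h"
  where "weaving J \<phi> \<psi> i = (if i \<in> J then \<phi> i else \<psi> i)"

definition universal_bounds ::
    "('h::banach \<Rightarrow> 'h \<Rightarrow> 'k::real_or_complex) \<Rightarrow> 'i set \<Rightarrow> ('i \<Rightarrow> 'h) \<Rightarrow> ('i \<Rightarrow> 'h) \<Rightarrow> real \<Rightarrow> real \<Rightarrow> bool"
  where "universal_bounds ip I \<phi> \<psi> A B \<longleftrightarrow> 0 < A \<and> A \<le> B \<and>
    (\<forall>J\<subseteq>I. frame_bounds ip I (weaving J \<phi> \<psi>) A B)"

definition woven :: "('h::banach \<Rightarrow> 'h \<Rightarrow> 'k::real_or_complex) \<Rightarrow> 'i set \<Rightarrow> ('i \<Rightarrow> 'h) \<Rightarrow> ('i \<Rightarrow> 'h) \<Rightarrow> bool"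
  where "woven ip I \<phi> \<psi> \<longleftrightarrow> is_frame ip I \<phi> \<and> is_frame ip I \<psi> \<and>
    (\<exists>A B. universal_bounds ip I \<phi> \<psi> A B)"

definition universal_lower_bound ::
    "('h::banach \<Rightarrow> 'h \<Rightarrow> 'k::real_or_complex) \<Rightarrow> 'i set \<Rightarrow> ('i \<Rightarrow> 'h) \<Rightarrow> ('i \<Rightarrow> 'h) \<Rightarrow> real \<Rightarrow> bool"
  where "universal_lower_bound ip I \<phi> \<psi> A \<longleftrightarrow> (\<exists>B. universal_bounds ip I \<phi> \<psi> A B)"

text \<open>
  This is the usual intrinsic form of a Riesz basis; the alternative definition as the image of
  an orthonormal basis under a bounded invertible operator describes the same families.
\<close>

definition riesz_basis ::
    "('k::real_or_complex \<Rightarrow> 'h::banach \<Rightarrow> 'h) \<Rightarrow> 'i set \<Rightarrow> ('i \<Rightarrow> 'h) \<Rightarrow> bool"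
  where "riesz_basis smul I \<phi> \<longleftrightarrow> closure (module.span smul (\<phi> ` I)) = UNIV \<and>
    (\<exists>A B. 0 < A \<and> A \<le> B \<and> (\<forall>F c. finite F \<and> F \<subseteq> I \<longrightarrow>
      A * (\<Sum>i\<in>F. (norm (c i))\<^sup>2) \<le> (norm (\<Sum>i\<in>F. smul (c i) (\<phi> i)))\<^sup>2 \<and>
      (norm (\<Sum>i\<in>F. smul (c i) (\<phi> i)))\<^sup>2 \<le> B * (\<Sum>i\<in>F. (norm (c i))\<^sup>2)))"

definition ecard :: "'i set \<Rightarrow> enat"
  where "ecard D = (if finite D then enat (card D) else \<infinity>)"

definition excess :: "('h::banach \<Rightarrow> 'h \<Rightarrow> 'k::real_or_complex) \<Rightarrow> 'i set \<Rightarrow> ('i \<Rightarrow> 'h) \<Rightarrow> enat"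
  where "excess ip I \<phi> = (SUP D \<in> {D. D \<subseteq> I \<and> is_frame ip (I - D) \<phi>}. ecard D)"

text \<open>
  The last conjunct covers both cases: \<open>\<sigma>\<close> has \<open>n\<close> elements when the excess is \<open>n\<close>, and is infinite
  when the excess is infinite.
\<close>

definition redundant_elements ::
    "('k::real_or_complex \<Rightarrow> 'h::banach \<Rightarrow> 'h) \<Rightarrow> ('h \<Rightarrow> 'h \<Rightarrow> 'k) \<Rightarrow> 'i set \<Rightarrow> ('i \<Rightarrow> 'h) \<Rightarrow> 'i set \<Rightarrow> bool"
  where "redundant_elements smul ip I \<phi> \<sigma> \<longleftrightarrow>
    \<sigma> \<subseteq> I \<and> riesz_basis smul (I - \<sigma>) \<phi> \<and> ecard \<sigma> = excess ip I \<phi>"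

text \<open>
  Summability is stated explicitly because an infinite sum that does not converge has the
  value 0 by convention.
\<close>

definition small_redundant_elements ::
    "('k::real_or_complex \<Rightarrow> 'h::banach \<Rightarrow> 'h) \<Rightarrow> ('h \<Rightarrow> 'h \<Rightarrow> 'k) \<Rightarrow> 'i set \<Rightarrow> ('i \<Rightarrow> 'h) \<Rightarrow> 'i set \<Rightarrow> bool"
  where "small_redundant_elements smul ip I \<phi> \<sigma> \<longleftrightarrow>
    (\<exists>A B. upper_frame_bound ip I \<phi> B \<and>
      universal_lower_bound ip (I - \<sigma>) \<phi> (\<lambda>i. frame_operator smul ip (I - \<sigma>) \<phi> (\<phi> i)) A \<and>
      (\<lambda>i. (norm (\<phi> i))\<^sup>2) summable_on \<sigma> \<and>
      (\<Sum>\<^sub>\<infinity>i\<in>\<sigma>. (norm (\<phi> i))\<^sup>2) < sqrt (A / B))"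

end

theory Submission
  imports Defs
begin

text \<open>
  Write \<open>\<psi>\<close> for the canonical dual of \<open>\<phi>\<close>. The reconstruction formula gives
  \<open>\<parallel>f\<parallel>\<^sup>2 = \<Sum>i. \<langle>f, \<psi> i\<rangle> \<langle>\<phi> i, f\<rangle>\<close>. In every weaving one of the two factors of the
  \<open>i\<close>-th term is a coefficient of the weaving, so the right-hand side is at most a small multiple of
  \<open>\<Sum>i. |\<langle>f, \<phi> i\<rangle>|\<^sup>2 + |\<langle>f, \<psi> i\<rangle>|\<^sup>2\<close>, which is absorbed in \<open>\<parallel>f\<parallel>\<^sup>2\<close>, plus a constant multiple of the
  squared coefficients of the weaving. That the frame operator is invertible follows from
  Banach's fixed point theorem, since \<open>f \<mapsto> f - S f / B\<close> is a contraction.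
\<close>

section \<open>Two analytic tools: unconditional summability and a weighted product
  inequality\<close>

text \<open>This is the Cauchy criterion along the finite subsets of \<open>I\<close>: the squared
  norm of a block of terms is at most a piece of the tail of \<open>g\<close>, and completeness does
  the rest. It serves series that need not converge absolutely, such as that of the frame
  operator.\<close>

lemma summable_on_square_dominated:
  fixes f :: "'i \<Rightarrow> 'h::banach" and g :: "'i \<Rightarrow> real"
  assumes g: "g summable_on I" and g0: "\<And>i. i \<in> I \<Longrightarrow> 0 \<le> g i"
    and le: "\<And>F. finite F \<Longrightarrow> F \<subseteq> I \<Longrightarrow> (norm (sum f F))\<^sup>2 \<le> sum g F"
  shows "f summable_on I"
proof -
  have "\<exists>P. eventually P (finite_subsets_at_top I) \<and>
          (\<forall>F F'. P F \<and> P F' \<longrightarrow> dist (sum f F) (sum f F') < e)" if "e > 0" for e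
  proof -
    \<comment> \<open>The tolerance is squared because \<open>le\<close> controls squared norms; the
      third of \<open>e\<close> keeps the final comparison of two sums through \<open>F0\<close>
      strict.\<close>
    obtain F0 where F0: "finite F0" "F0 \<subseteq> I" "dist (sum g F0) (infsum g I) \<le> (e/3)\<^sup>2"
      using has_sum_finite_approximation[OF has_sum_infsum[OF g], of "(e/3)\<^sup>2"] \<open>e > 0\<close> by auto
    have near: "dist (sum f F) (sum f F0) \<le> e/3" if F: "finite F" "F0 \<subseteq> F" "F \<subseteq> I" for F
    proof -
      have "(dist (sum f F) (sum f F0))\<^sup>2 = (norm (sum f (F - F0)))\<^sup>2"
        using F by (simp add: dist_norm sum_diff)
      also have "\<dots> \<le> sum g (F - F0)"
        using F by (intro le) auto
      also have "\<dots> = sum g F - sum g F0"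
        using F by (simp add: sum_diff)
      also have "\<dots> \<le> infsum g I - sum g F0"
        using finite_sum_le_infsum[OF g, of F] F g0 by auto
      also have "\<dots> \<le> (e/3)\<^sup>2"
        using F0(3) by (auto simp: dist_real_def)
      finally show ?thesis
        using \<open>e > 0\<close> by (auto simp: abs_le_square_iff [symmetric])
    qed
    have "dist (sum f F) (sum f F') < e"
      if "finite F" "F0 \<subseteq> F" "F \<subseteq> I" "finite F'" "F0 \<subseteq> F'" "F' \<subseteq> I" for F F'
      using near[of F] near[of F'] dist_triangle2[of "sum f F" "sum f F'" "sum f F0"] that \<open>e > 0\<close>
      by auto
    then show ?thesis
      using F0 by (intro exI[of _ "\<lambda>F. finite F \<and> F0 \<subseteq> F \<and> F \<subseteq> I"])
        (auto simp: eventually_finite_subsets_at_top)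
  qed
  then have "cauchy_filter (filtermap (sum f) (finite_subsets_at_top I))"
    by (simp add: cauchy_filter_metric_filtermap)
  moreover have "complete (UNIV :: 'h set)"
    by (meson Cauchy_convergent UNIV_I complete_def convergent_def)
  ultimately obtain L where "(sum f \<longlongrightarrow> L) (finite_subsets_at_top I)"
    using complete_uniform[where S=UNIV] by (force simp add: filterlim_def)
  then show ?thesis
    using summable_on_def has_sum_def by blast
qed

text \<open>The two sides differ by a perfect square over \<open>2 * t\<close>. The free weight
  \<open>t\<close> lets one of the squares be absorbed later.\<close>

lemma mult_le_weighted_squares:
  fixes a b t :: real
  assumes "t > 0"
  shows "a * b \<le> t / 2 * a\<^sup>2 + b\<^sup>2 / (2 * t)"
proof -
  have "t / 2 * a\<^sup>2 + b\<^sup>2 / (2 * t) - a * b = (t * a - b)\<^sup>2 / (2 * t)"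
    using assms by (simp add: field_simps power2_eq_square)
  also have "\<dots> \<ge> 0" using assms by simp
  finally show ?thesis by simp
qed

section \<open>Conjugation of scalars\<close>

lemma scnj_zero [simp]: "scnj (0 :: 'k::real_or_complex) = 0"
  by (metis scaleR_zero_left scnj_scaleR)

lemma scnj_one [simp]: "scnj (1 :: 'k::real_or_complex) = 1"
  using mult_scnj[of "1 :: 'k"] by simp

lemma scnj_of_real [simp]: "scnj (of_real r :: 'k::real_or_complex) = of_real r"
  by (simp add: of_real_def scnj_scaleR)

lemma norm_scnj [simp]: "norm (scnj a) = norm (a :: 'k::real_or_complex)"
proof (cases "a = 0")
  case False
  have "norm a * norm (scnj a) = norm a * norm a"
    using arg_cong[OF mult_scnj[of a], of norm] by (simp add: norm_mult power2_eq_square)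
  with False show ?thesis by simp
qed simp

lemma mult_scnj_of_real: "a * scnj a = of_real ((norm a)\<^sup>2)" for a :: "'k::real_or_complex"
  by (simp add: mult_scnj of_real_def)

lemma bounded_linear_scnj: "bounded_linear (scnj :: 'k::real_or_complex \<Rightarrow> 'k)"
  by (rule bounded_linear_intro[where K=1]) (simp_all add: scnj_add scnj_scaleR)

context hilbert_space
begin

section \<open>Inner product calculus and the Cauchy-Schwarz inequality\<close>

lemma ip_scaleR_left: "ip (r *\<^sub>R x) y = r *\<^sub>R ip x y"
  by (simp add: scale_of_real[symmetric] ip_scale_left scaleR_conv_of_real)

lemma ip_minus_left: "ip (- x) y = - ip x y"
  using ip_scaleR_left[of "-1" x y] by simp

lemma ip_diff_left: "ip (x - y) z = ip x z - ip y z"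
  using ip_add_left[of x "- y" z] by (simp add: ip_minus_left)

lemma ip_add_right: "ip x (y + z) = ip x y + ip x z"
  by (metis ip_add_left ip_commute scnj_add)

lemma ip_scale_right: "ip x (smul a y) = scnj a * ip x y"
  by (metis ip_commute ip_scale_left scnj_mult)

lemma ip_scaleR_right: "ip x (r *\<^sub>R y) = r *\<^sub>R ip x y"
  by (metis ip_commute ip_scaleR_left scnj_scaleR)

lemma ip_minus_right: "ip x (- y) = - ip x y"
  using ip_scaleR_right[of x "-1" y] by simp

lemma ip_diff_right: "ip x (y - z) = ip x y - ip x z"
  using ip_add_right[of x y "- z"] by (simp add: ip_minus_right)

lemma norm_ip_commute: "norm (ip x y) = norm (ip y x)"
  by (metis ip_commute norm_scnj)

lemma ip_mult_commute: "ip x y * ip y x = of_real ((norm (ip x y))\<^sup>2)"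
  by (metis ip_commute mult_scnj_of_real)

lemma norm_ip_self: "norm (ip x x) = (norm x)\<^sup>2"
  by (simp add: ip_self norm_power)

lemma norm_ip_le: "norm (ip x y) \<le> norm x * norm y"
proof (cases "y = 0")
  case True
  then show ?thesis using ip_scaleR_right[of x 0 y] by simp
next
  case False
  \<comment> \<open>\<open>smul c y\<close> is the orthogonal projection of \<open>x\<close> onto
    the line through \<open>y\<close>; the squared norm of the remainder is nonnegative, which is
    the claim.\<close>
  define c where "c = ip x y / of_real ((norm y)\<^sup>2)"
  have ny: "of_real (norm y) \<noteq> (0 :: 'k)" using False by simp
  have "ip (x - smul c y) y = 0"
    using ny by (simp add: ip_diff_left ip_scale_left ip_self c_def)
  then have "ip (x - smul c y) (x - smul c y) = ip x x - c * ip y x"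
    by (simp add: ip_diff_right ip_scale_right ip_diff_left ip_scale_left)
  also have "\<dots> = of_real ((norm x)\<^sup>2 - (norm (ip x y))\<^sup>2 / (norm y)\<^sup>2)"
    by (simp add: c_def ip_self ip_mult_commute)
  finally have "(norm (x - smul c y))\<^sup>2 = (norm x)\<^sup>2 - (norm (ip x y))\<^sup>2 / (norm y)\<^sup>2"
    unfolding ip_self of_real_eq_iff .
  then have "(norm (ip x y))\<^sup>2 / (norm y)\<^sup>2 \<le> (norm x)\<^sup>2"
    using zero_le_power2[of "norm (x - smul c y)"] by linarith
  then have "(norm (ip x y))\<^sup>2 \<le> (norm x * norm y)\<^sup>2"
    using False by (simp add: field_simps power_mult_distrib)
  then show ?thesis by (rule power2_le_imp_le) simp
qed

lemma bounded_linear_ip_left: "bounded_linear (\<lambda>x. ip x y)"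
  by (rule bounded_linear_intro[where K="norm y"])
    (simp_all add: ip_add_left ip_scaleR_left norm_ip_le)

text \<open>A real inner product makes the two cross terms equal. It is meant for a vector
  \<open>x\<close> and its image \<open>y\<close> under the frame operator.\<close>

lemma norm_diff_square:
  assumes "ip y x = of_real q"
  shows "(norm (x - r *\<^sub>R y))\<^sup>2 = (norm x)\<^sup>2 - 2 * r * q + r\<^sup>2 * (norm y)\<^sup>2"
proof -
  have "ip x y = of_real q"
    using ip_commute[of x y] assms by simp
  then have "ip (x - r *\<^sub>R y) (x - r *\<^sub>R y) =
      of_real ((norm x)\<^sup>2 - 2 * r * q + r\<^sup>2 * (norm y)\<^sup>2)"
    using assms
    by (simp add: ip_diff_left ip_diff_right ip_scaleR_left ip_scaleR_right ip_self[of x] ip_self[of y]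
        scaleR_conv_of_real algebra_simps power2_eq_square)
  then show ?thesis
    unfolding ip_self of_real_eq_iff .
qed

section \<open>The frame operator\<close>

text \<open>Pairing the series with its own sum \<open>x\<close> expresses the squared norm of
  \<open>x\<close> through products of \<open>c i\<close> with frame coefficients of
  \<open>x\<close>. With weight \<open>B\<close> the upper frame bound turns the coefficient part
  into half of that squared norm, which is absorbed on the left.\<close>

lemma synthesis_bound:
  assumes "frame_bounds ip I \<phi> A B" "F \<subseteq> I"
    and x: "((\<lambda>i. smul (c i) (\<phi> i)) has_sum x) F"
    and c: "(\<lambda>i. (norm (c i))\<^sup>2) summable_on F"
  shows "(norm x)\<^sup>2 \<le> B * (\<Sum>\<^sub>\<infinity>i\<in>F. (norm (c i))\<^sup>2)"
proof -
  let ?C = "\<Sum>\<^sub>\<infinity>i\<in>F. (norm (c i))\<^sup>2" and ?X = "\<Sum>\<^sub>\<infinity>i\<in>F. (norm (ip x (\<phi> i)))\<^sup>2"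
  have B: "B > 0" and sX: "(\<lambda>i. (norm (ip x (\<phi> i)))\<^sup>2) summable_on I"
    and leX: "(\<Sum>\<^sub>\<infinity>i\<in>I. (norm (ip x (\<phi> i)))\<^sup>2) \<le> B * (norm x)\<^sup>2"
    using assms(1) unfolding frame_bounds_def by auto
  have sXF: "(\<lambda>i. (norm (ip x (\<phi> i)))\<^sup>2) summable_on F"
    by (rule summable_on_subset_banach[OF sX \<open>F \<subseteq> I\<close>])
  have "?X \<le> (\<Sum>\<^sub>\<infinity>i\<in>I. (norm (ip x (\<phi> i)))\<^sup>2)"
    using \<open>F \<subseteq> I\<close> by (intro infsum_mono2 sX sXF) auto
  with leX have X: "?X \<le> B * (norm x)\<^sup>2" by simp
  have "((\<lambda>i. ip (smul (c i) (\<phi> i)) x) has_sum ip x x) F"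
    by (rule has_sum_bounded_linear[OF bounded_linear_ip_left x])
  moreover have "((\<lambda>i. (B / 2) * (norm (c i))\<^sup>2 + (1 / (2 * B)) * (norm (ip x (\<phi> i)))\<^sup>2)
      has_sum ((B / 2) * ?C + (1 / (2 * B)) * ?X)) F"
    by (intro has_sum_add has_sum_cmult_right has_sum_infsum c sXF)
  moreover have "norm (ip (smul (c i) (\<phi> i)) x) \<le>
      (B / 2) * (norm (c i))\<^sup>2 + (1 / (2 * B)) * (norm (ip x (\<phi> i)))\<^sup>2" for i
    using mult_le_weighted_squares[OF B, of "norm (c i)" "norm (ip x (\<phi> i))"]
    by (simp add: ip_scale_left norm_mult norm_ip_commute[of _ x])
  ultimately have "norm (ip x x) \<le> (B / 2) * ?C + (1 / (2 * B)) * ?X"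
    by (rule norm_infsum_le)
  also have "\<dots> \<le> (B / 2) * ?C + (1 / (2 * B)) * (B * (norm x)\<^sup>2)"
    using X B by (intro add_left_mono mult_left_mono) auto
  also have "\<dots> = B * ?C / 2 + (norm x)\<^sup>2 / 2"
    using B by simp
  finally show ?thesis
    by (simp add: norm_ip_self)
qed

text \<open>The infinite sum defining the operator would be 0 by convention if it diverged, so
  convergence comes first. The finite case of \<open>synthesis_bound\<close> is exactly the
  domination that the Cauchy criterion asks for.\<close>

lemma frame_operator_has_sum:
  assumes "frame_bounds ip I \<phi> A B"
  shows "((\<lambda>i. smul (ip f (\<phi> i)) (\<phi> i)) has_sum frame_operator smul ip I \<phi> f) I"
proof -
  have B: "B > 0" and s: "(\<lambda>i. (norm (ip f (\<phi> i)))\<^sup>2) summable_on I"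
    using assms unfolding frame_bounds_def by auto
  have "(\<lambda>i. smul (ip f (\<phi> i)) (\<phi> i)) summable_on I"
  proof (rule summable_on_square_dominated)
    show "(\<lambda>i. B * (norm (ip f (\<phi> i)))\<^sup>2) summable_on I"
      by (intro summable_on_cmult_right s)
    show "(norm (\<Sum>i\<in>F. smul (ip f (\<phi> i)) (\<phi> i)))\<^sup>2 \<le> (\<Sum>i\<in>F. B * (norm (ip f (\<phi> i)))\<^sup>2)"
      if "finite F" "F \<subseteq> I" for F
      using synthesis_bound[OF assms that(2) has_sum_finite[OF that(1)], of "\<lambda>i. ip f (\<phi> i)"] that
      by (simp add: sum_distrib_left)
  qed (use B in auto)
  then show ?thesis
    unfolding frame_operator_def by (rule has_sum_infsum)
qed

lemma ip_frame_operator: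
  assumes "frame_bounds ip I \<phi> A B"
  shows "((\<lambda>i. ip f (\<phi> i) * ip (\<phi> i) g) has_sum ip (frame_operator smul ip I \<phi> f) g) I"
  using has_sum_bounded_linear[OF bounded_linear_ip_left frame_operator_has_sum[OF assms]]
  by (simp add: ip_scale_left)

text \<open>Conjugating the series of \<open>ip (S g) f\<close> term by term, with \<open>S\<close>
  the frame operator, yields the series of \<open>ip (S f) g\<close>; sums are unique.\<close>

lemma frame_operator_selfadjoint:
  assumes "frame_bounds ip I \<phi> A B"
  shows "ip (frame_operator smul ip I \<phi> f) g = ip f (frame_operator smul ip I \<phi> g)"
proof -
  have "((\<lambda>i. scnj (ip g (\<phi> i) * ip (\<phi> i) f)) has_sum
      scnj (ip (frame_operator smul ip I \<phi> g) f)) I"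
    by (rule has_sum_bounded_linear[OF bounded_linear_scnj ip_frame_operator[OF assms]])
  also have "(\<lambda>i. scnj (ip g (\<phi> i) * ip (\<phi> i) f)) = (\<lambda>i. ip f (\<phi> i) * ip (\<phi> i) g)"
    by (simp add: scnj_mult ip_commute[symmetric] mult.commute)
  finally show ?thesis
    using ip_frame_operator[OF assms] has_sum_unique by (metis ip_commute)
qed

lemma ip_frame_operator_self:
  assumes "frame_bounds ip I \<phi> A B"
  shows "ip (frame_operator smul ip I \<phi> f) f = of_real (\<Sum>\<^sub>\<infinity>i\<in>I. (norm (ip f (\<phi> i)))\<^sup>2)"
proof -
  have "((\<lambda>i. of_real ((norm (ip f (\<phi> i)))\<^sup>2) :: 'k) has_sum
      of_real (\<Sum>\<^sub>\<infinity>i\<in>I. (norm (ip f (\<phi> i)))\<^sup>2)) I"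
    using assms unfolding frame_bounds_def
    by (intro has_sum_bounded_linear[OF bounded_linear_of_real] has_sum_infsum) auto
  with ip_frame_operator[OF assms, of f f] show ?thesis
    unfolding ip_mult_commute by (rule has_sum_unique)
qed

lemma frame_operator_diff:
  assumes "frame_bounds ip I \<phi> A B"
  shows "frame_operator smul ip I \<phi> (f - g) =
    frame_operator smul ip I \<phi> f - frame_operator smul ip I \<phi> g"
proof -
  have "((\<lambda>i. smul (ip (f - g) (\<phi> i)) (\<phi> i) + smul (ip g (\<phi> i)) (\<phi> i)) has_sum
      frame_operator smul ip I \<phi> (f - g) + frame_operator smul ip I \<phi> g) I"
    by (intro has_sum_add frame_operator_has_sum[OF assms])
  then have "((\<lambda>i. smul (ip f (\<phi> i)) (\<phi> i)) has_sum
      frame_operator smul ip I \<phi> (f - g) + frame_operator smul ip I \<phi> g) I"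
    by (simp add: scale_left_distrib[symmetric] ip_diff_left)
  with frame_operator_has_sum[OF assms, of f]
  have "frame_operator smul ip I \<phi> f =
      frame_operator smul ip I \<phi> (f - g) + frame_operator smul ip I \<phi> g"
    by (rule has_sum_unique)
  then show ?thesis by simp
qed

lemma norm_diff_frame_operator_le:
  assumes "frame_bounds ip I \<phi> A B"
  shows "(norm (f - (1 / B) *\<^sub>R frame_operator smul ip I \<phi> f))\<^sup>2 \<le> (1 - A / B) * (norm f)\<^sup>2"
proof -
  let ?S = "frame_operator smul ip I \<phi>" and ?Q = "\<Sum>\<^sub>\<infinity>i\<in>I. (norm (ip f (\<phi> i)))\<^sup>2"
  have B: "B > 0" and s: "(\<lambda>i. (norm (ip f (\<phi> i)))\<^sup>2) summable_on I" and Q: "A * (norm f)\<^sup>2 \<le> ?Q"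
    using assms unfolding frame_bounds_def by auto
  have "(norm (f - (1 / B) *\<^sub>R ?S f))\<^sup>2 =
      (norm f)\<^sup>2 - 2 * (1 / B) * ?Q + (1 / B)\<^sup>2 * (norm (?S f))\<^sup>2"
    by (rule norm_diff_square[OF ip_frame_operator_self[OF assms]])
  \<comment> \<open>With \<open>c i = ip f (\<phi> i)\<close>, \<open>synthesis_bound\<close> gives
    \<open>(norm (?S f))\<^sup>2 \<le> B * ?Q\<close>, so the quadratic term takes back only half of
    the gain \<open>2 * ?Q / B\<close>.\<close>
  also have "\<dots> \<le> (norm f)\<^sup>2 - 2 * (1 / B) * ?Q + (1 / B)\<^sup>2 * (B * ?Q)"
    using synthesis_bound[OF assms subset_refl frame_operator_has_sum[OF assms] s]
    by (intro add_left_mono mult_left_mono) auto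
  also have "\<dots> = (norm f)\<^sup>2 - ?Q / B"
    using B by (simp add: field_simps power2_eq_square)
  also have "\<dots> \<le> (norm f)\<^sup>2 - A * (norm f)\<^sup>2 / B"
    using Q B by (intro diff_left_mono divide_right_mono) auto
  finally show ?thesis
    by (simp add: algebra_simps)
qed

section \<open>Invertibility of the frame operator\<close>

text \<open>Solutions of \<open>S f = h\<close> are the fixed points of
  \<open>f - (1 / B) *\<^sub>R (S f - h)\<close>. The shift by \<open>h\<close> cancels in
  differences, so the contraction constant \<open>sqrt (1 - A / B)\<close> is the same for all
  \<open>h\<close>; it is below 1 because \<open>0 < A \<le> B\<close>.\<close>

lemma bij_frame_operator:
  assumes "frame_bounds ip I \<phi> A B"
  shows "bij (frame_operator smul ip I \<phi>)"
proof -
  let ?S = "frame_operator smul ip I \<phi>"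
  have A: "0 < A" "A \<le> B" using assms unfolding frame_bounds_def by auto
  have contraction: "dist (f - (1 / B) *\<^sub>R (?S f - h)) (g - (1 / B) *\<^sub>R (?S g - h))
      \<le> sqrt (1 - A / B) * dist f g" for f g h
  proof -
    have eq: "f - (1 / B) *\<^sub>R (?S f - h) - (g - (1 / B) *\<^sub>R (?S g - h)) =
        (f - g) - (1 / B) *\<^sub>R ?S (f - g)"
      by (simp add: frame_operator_diff[OF assms] scaleR_diff_right)
    show ?thesis
      unfolding dist_norm eq
      using real_sqrt_le_mono[OF norm_diff_frame_operator_le[OF assms, of "f - g"]]
      by (simp add: real_sqrt_mult)
  qed
  have fixpoint: "\<exists>!f. f - (1 / B) *\<^sub>R (?S f - h) = f" for h
    using A by (intro banach_fix_type[where c="sqrt (1 - A / B)"] allI contraction) auto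
  have "\<exists>!f. ?S f = h" for h
    using fixpoint[of h] A by simp
  then show ?thesis
    by (simp add: bij_iff)
qed

section \<open>Weaving a frame with a dual\<close>

text \<open>Upper bounds for both families and the reconstruction formula force a lower bound for
  each weaving. The constant \<open>D\<close> is chosen before \<open>J\<close>, which makes the
  bounds universal.\<close>

lemma dual_pair_universal_bounds:
  assumes \<phi>: "\<And>f. (\<lambda>i. (norm (ip f (\<phi> i)))\<^sup>2) summable_on I"
      "\<And>f. (\<Sum>\<^sub>\<infinity>i\<in>I. (norm (ip f (\<phi> i)))\<^sup>2) \<le> B * (norm f)\<^sup>2"
    and \<psi>: "\<And>f. (\<lambda>i. (norm (ip f (\<psi> i)))\<^sup>2) summable_on I"
      "\<And>f. (\<Sum>\<^sub>\<infinity>i\<in>I. (norm (ip f (\<psi> i)))\<^sup>2) \<le> C * (norm f)\<^sup>2"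
    and dual: "\<And>f. ((\<lambda>i. ip f (\<psi> i) * ip (\<phi> i) f) has_sum ip f f) I"
    and D: "1 \<le> D" "B + C \<le> D"
  shows "universal_bounds ip I \<phi> \<psi> (1 / D) D"
proof -
  have "(\<lambda>i. (norm (ip f (weaving J \<phi> \<psi> i)))\<^sup>2) summable_on I \<and>
      1 / D * (norm f)\<^sup>2 \<le> (\<Sum>\<^sub>\<infinity>i\<in>I. (norm (ip f (weaving J \<phi> \<psi> i)))\<^sup>2) \<and>
      (\<Sum>\<^sub>\<infinity>i\<in>I. (norm (ip f (weaving J \<phi> \<psi> i)))\<^sup>2) \<le> D * (norm f)\<^sup>2" for J f
  proof -
    define a where "a i = norm (ip f (\<phi> i))" for i
    define b where "b i = norm (ip f (\<psi> i))" for i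
    define w where "w i = norm (ip f (weaving J \<phi> \<psi> i))" for i
    have w: "w i = (if i \<in> J then a i else b i)" for i
      by (simp add: w_def a_def b_def weaving_def)
    let ?AB = "\<Sum>\<^sub>\<infinity>i\<in>I. (a i)\<^sup>2 + (b i)\<^sup>2" and ?W = "\<Sum>\<^sub>\<infinity>i\<in>I. (w i)\<^sup>2"
    have sa: "(\<lambda>i. (a i)\<^sup>2) summable_on I" and sb: "(\<lambda>i. (b i)\<^sup>2) summable_on I"
      unfolding a_def b_def by (fact \<phi> \<psi>)+
    have sab: "(\<lambda>i. (a i)\<^sup>2 + (b i)\<^sup>2) summable_on I"
      by (intro summable_on_add sa sb)
    have w_le: "(w i)\<^sup>2 \<le> (a i)\<^sup>2 + (b i)\<^sup>2" for i
      by (simp add: w)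
    have sw: "(\<lambda>i. (w i)\<^sup>2) summable_on I"
      by (rule summable_on_comparison_test[OF sab]) (auto simp: w_le)
    have "?AB = (\<Sum>\<^sub>\<infinity>i\<in>I. (a i)\<^sup>2) + (\<Sum>\<^sub>\<infinity>i\<in>I. (b i)\<^sup>2)"
      by (intro infsum_add sa sb)
    also have "\<dots> \<le> B * (norm f)\<^sup>2 + C * (norm f)\<^sup>2"
      unfolding a_def b_def by (intro add_mono \<phi> \<psi>)
    also have "\<dots> \<le> D * (norm f)\<^sup>2"
      using D by (simp add: distrib_right[symmetric] mult_right_mono)
    finally have AB: "?AB \<le> D * (norm f)\<^sup>2" .
    have upper: "?W \<le> D * (norm f)\<^sup>2"
      using infsum_mono[OF sw sab w_le] AB by simp
    \<comment> \<open>The right-hand side is a majorant of one shape for all \<open>i\<close>: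
      weight \<open>D / 2\<close> goes to the coefficient present in the weaving, and the small
      weight \<open>1 / (2 * D)\<close> to both, so that the total of the latter is
      \<open>?AB\<close>.\<close>
    have "((\<lambda>i. (1 / (2 * D)) * ((a i)\<^sup>2 + (b i)\<^sup>2) + (D / 2) * (w i)\<^sup>2)
        has_sum ((1 / (2 * D)) * ?AB + (D / 2) * ?W)) I"
      by (intro has_sum_add has_sum_cmult_right has_sum_infsum sab sw)
    moreover have "norm (ip f (\<psi> i) * ip (\<phi> i) f) \<le>
        (1 / (2 * D)) * ((a i)\<^sup>2 + (b i)\<^sup>2) + (D / 2) * (w i)\<^sup>2" for i
    proof -
      have "norm (ip f (\<psi> i) * ip (\<phi> i) f) = a i * b i"
        by (simp add: norm_mult a_def b_def norm_ip_commute[of f] mult.commute)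
      also have "\<dots> \<le> (1 / (2 * D)) * ((a i)\<^sup>2 + (b i)\<^sup>2) + (D / 2) * (w i)\<^sup>2"
      proof (cases "i \<in> J")
        case True
        have "a i * b i \<le> (D / 2) * (a i)\<^sup>2 + (1 / (2 * D)) * (b i)\<^sup>2"
          using mult_le_weighted_squares[of D "a i" "b i"] D by simp
        moreover have "0 \<le> (1 / (2 * D)) * (a i)\<^sup>2"
          using D by simp
        ultimately show ?thesis
          using True by (simp only: w if_True distrib_left)
      next
        case False
        have "a i * b i \<le> (D / 2) * (b i)\<^sup>2 + (1 / (2 * D)) * (a i)\<^sup>2"
          using mult_le_weighted_squares[of D "b i" "a i"] D by (simp add: mult.commute)
        moreover have "0 \<le> (1 / (2 * D)) * (b i)\<^sup>2"
          using D by simp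
        ultimately show ?thesis
          using False by (simp only: w if_False distrib_left)
      qed
      finally show ?thesis .
    qed
    ultimately have "norm (ip f f) \<le> (1 / (2 * D)) * ?AB + (D / 2) * ?W"
      by (rule norm_infsum_le[OF dual])
    \<comment> \<open>The weight is tuned to \<open>?AB \<le> D * (norm f)\<^sup>2\<close>: the
      first term becomes half of the squared norm of \<open>f\<close> and moves to the left.\<close>
    also have "\<dots> \<le> (1 / (2 * D)) * (D * (norm f)\<^sup>2) + (D / 2) * ?W"
      using AB D by (intro add_right_mono mult_left_mono) auto
    also have "\<dots> = (norm f)\<^sup>2 / 2 + D * ?W / 2"
      using D by simp
    finally have "(norm f)\<^sup>2 \<le> D * ?W"
      by (simp add: norm_ip_self)
    then have "1 / D * (norm f)\<^sup>2 \<le> ?W"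
      using D by (simp add: field_simps)
    with sw upper show ?thesis
      by (simp add: w_def)
  qed
  moreover have "1 / D \<le> D"
    using D by (meson divide_le_eq_1_pos le_numeral_extra(4) order_trans zero_less_one less_le_trans)
  ultimately show ?thesis
    using D unfolding universal_bounds_def frame_bounds_def by auto
qed

lemma frame_woven_canonical_dual:
  assumes "is_frame ip I \<phi>"
  shows "woven ip I \<phi> (canonical_dual smul ip I \<phi>)"
proof -
  let ?S = "frame_operator smul ip I \<phi>" and ?\<psi> = "canonical_dual smul ip I \<phi>"
  obtain A B where fb: "frame_bounds ip I \<phi> A B"
    using assms unfolding is_frame_def by blast
  have A: "0 < A" "0 < B"
    and s: "\<And>f. (\<lambda>i. (norm (ip f (\<phi> i)))\<^sup>2) summable_on I"
    and lo: "\<And>f. A * (norm f)\<^sup>2 \<le> (\<Sum>\<^sub>\<infinity>i\<in>I. (norm (ip f (\<phi> i)))\<^sup>2)"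
    and up: "\<And>f. (\<Sum>\<^sub>\<infinity>i\<in>I. (norm (ip f (\<phi> i)))\<^sup>2) \<le> B * (norm f)\<^sup>2"
    using fb unfolding frame_bounds_def by auto
  \<comment> \<open>Surjectivity is what makes \<open>inv\<close>, a mere choice of preimage, a
    right inverse.\<close>
  have S_inv: "?S (inv ?S f) = f" for f
    by (rule surj_f_inv_f[OF bij_is_surj[OF bij_frame_operator[OF fb]]])
  \<comment> \<open>Self-adjointness moves the inverse to the other side, so the dual's coefficients
    of \<open>f\<close> are frame coefficients of \<open>inv ?S f\<close>.\<close>
  have coeff: "ip f (?\<psi> i) = ip (inv ?S f) (\<phi> i)" for f i
    using frame_operator_selfadjoint[OF fb, of "inv ?S f" "inv ?S (\<phi> i)"]
    by (simp add: S_inv canonical_dual_def)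
  \<comment> \<open>For \<open>g = inv ?S f\<close>, the lower frame bound and Cauchy-Schwarz
    enclose \<open>ip f g = ip (?S g) g\<close>; one factor \<open>norm g\<close> then
    cancels.\<close>
  have inv_bound: "A * norm (inv ?S f) \<le> norm f" for f
  proof -
    have "A * (norm (inv ?S f))\<^sup>2 \<le> (\<Sum>\<^sub>\<infinity>i\<in>I. (norm (ip (inv ?S f) (\<phi> i)))\<^sup>2)"
      by (rule lo)
    also have "\<dots> \<le> norm (ip f (inv ?S f))"
      using ip_frame_operator_self[OF fb, of "inv ?S f"] by (simp add: S_inv)
    also have "\<dots> \<le> norm f * norm (inv ?S f)"
      by (rule norm_ip_le)
    finally show ?thesis
      by (cases "inv ?S f = 0") (simp_all add: power2_eq_square)
  qed
  have "(\<Sum>\<^sub>\<infinity>i\<in>I. (norm (ip f (?\<psi> i)))\<^sup>2) \<le> B / A\<^sup>2 * (norm f)\<^sup>2" for f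
  proof -
    have "(norm (inv ?S f))\<^sup>2 \<le> (norm f / A)\<^sup>2"
      using inv_bound[of f] A by (intro power_mono) (simp_all add: field_simps)
    then have "B * (norm (inv ?S f))\<^sup>2 \<le> B * (norm f / A)\<^sup>2"
      using A by simp
    then show ?thesis
      using up[of "inv ?S f"] by (simp add: coeff power_divide)
  qed
  \<comment> \<open>This is the series of \<open>ip (?S g) f\<close> at
    \<open>g = inv ?S f\<close>.\<close>
  moreover have "((\<lambda>i. ip f (?\<psi> i) * ip (\<phi> i) f) has_sum ip f f) I" for f
    using ip_frame_operator[OF fb, of "inv ?S f" f] by (simp add: coeff S_inv)
  \<comment> \<open>The sum \<open>1 + B + B / A\<^sup>2\<close> meets both demands on
    \<open>D\<close>: at least 1, and at least the two upper bounds together.\<close>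
  ultimately have ub: "universal_bounds ip I \<phi> ?\<psi>
      (1 / (1 + B + B / A\<^sup>2)) (1 + B + B / A\<^sup>2)"
    using A by (intro dual_pair_universal_bounds[where B=B and C="B / A\<^sup>2"] s up)
      (simp_all add: coeff s)
  \<comment> \<open>The choice \<open>J = {}\<close> makes the dual itself one of the weavings,
    hence a frame.\<close>
  moreover have "weaving {} \<phi> ?\<psi> = ?\<psi>"
    by (simp add: weaving_def fun_eq_iff)
  ultimately have "is_frame ip I ?\<psi>"
    unfolding universal_bounds_def is_frame_def by (metis empty_subsetI)
  with ub assms show ?thesis
    unfolding woven_def by blast
qed

end

theorem theorem3p6:
  fixes smul :: "'k::real_or_complex \<Rightarrow> 'h::banach \<Rightarrow> 'h"
    and ip :: "'h \<Rightarrow> 'h \<Rightarrow> 'k"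
    and I :: "'i set"
    and \<phi> :: "'i \<Rightarrow> 'h"
    and \<sigma> :: "'i set"
  assumes "hilbert_space smul ip"
    and "separable_space (euclidean :: 'h topology)"
    and "countable I"
    and "is_frame ip I \<phi>"
    and "redundant_elements smul ip I \<phi> \<sigma>"
    and "small_redundant_elements smul ip I \<phi> \<sigma>"
  shows "woven ip I \<phi> (canonical_dual smul ip I \<phi>)"
  using assms(1,4) by (rule hilbert_space.frame_woven_canonical_dual)

end
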